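(* Let $m$ be a positive integer and let $A=\{a_s(n_s)\}_{s=1}^k$ be a finite system of residue classes, where $a_s\in\mathbb{Z}$, $n_s$ is a positive integer and $a_s(n_s)=a_s+n_s\mathbb{Z}$, such that $A$ forms an $m$-cover of $\mathbb{Z}$. Let $m_1,\ldots,m_k$ be any integers. Then for any real $\theta$ with $0\le\theta<1$, the set $$I_A(\theta)=\Big\{I\subseteq\{1,\ldots,k\}:\ \Big\{\sum_{s\in I}\frac{m_s}{n_s}\Big\}=\theta\Big\}$$ is either empty or has at least $2^m$ elements.
   Context: A finite system $\{a_s(n_s)\}_{s=1}^k$ is an $m$-cover of $\mathbb{Z}$ if every integer lies in at least $m$ of the sets $a_s+n_s\mathbb{Z}$ (counted with multiplicity over $s=1,\ldots,k$). For a real number $\alpha$, $\{\alpha\}$ denotes its fractional part $\alpha-\lfloor\alpha\rfloor$. *)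

theory Defs
  imports Complex_Main
begin

definition residue_class :: "int \<Rightarrow> int \<Rightarrow> int set" where
  "residue_class a n = {a + n * q | q. True}"

text \<open>
  A system \<open>{a\<^sub>s(n\<^sub>s)}\<close> is given by \<open>k\<close> and functions \<open>a\<close>, \<open>n\<close>, of which only the values on
  \<open>{1..k}\<close> matter. Counting indices rather than sets makes repeated classes count with multiplicity.
\<close>

definition m_cover :: "nat \<Rightarrow> nat \<Rightarrow> (nat \<Rightarrow> int) \<Rightarrow> (nat \<Rightarrow> int) \<Rightarrow> bool" where
  "m_cover m k a n \<longleftrightarrow> (\<forall>x. card {s \<in> {1..k}. x \<in> residue_class (a s) (n s)} \<ge> m)"

definition I_A :: "nat \<Rightarrow> (nat \<Rightarrow> int) \<Rightarrow> (nat \<Rightarrow> int) \<Rightarrow> real \<Rightarrow> nat set set" where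
  "I_A k n c \<theta> = {I. I \<subseteq> {1..k} \<and> frac (\<Sum>s\<in>I. real_of_int (c s) / real_of_int (n s)) = \<theta>}"

end

theory Submission
  imports Defs "HOL-Computational_Algebra.Polynomial"
begin

text \<open>
  Give each index set \<open>I\<close> in \<open>I\<^sub>A(\<theta>)\<close> the weight \<open>\<Prod>\<^bsub>s\<in>I\<^esub> (-e(-a\<^sub>s c\<^sub>s/n\<^sub>s))\<close>, where \<open>e(t) = exp(2 \<pi> i t)\<close>,
  and every other index set weight \<open>0\<close>. Let \<open>J\<close> have fewer than \<open>m\<close> elements. Then the classes
  outside \<open>J\<close> still cover the integers, so \<open>\<Prod>\<^bsub>s\<notin>J\<^esub> (1 - e((x - a\<^sub>s) c\<^sub>s/n\<^sub>s)) = 0\<close> for every integer \<open>x\<close>.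
  Expanding this product and comparing the coefficients of each character of \<open>x\<close> shows that the
  weights of the sets \<open>I \<supseteq> J\<close> sum to \<open>0\<close>. A nonzero function on the cube \<open>{0,1}\<^sup>k\<close> with this property
  for all such \<open>J\<close> is a codeword of a Reed--Muller type code of minimum distance \<open>2\<^sup>m\<close>.
\<close>

text \<open>Induction on the dimension of the cube, split by whether \<open>s\<close> lies in
  \<open>I\<close>. The upper half satisfies the vanishing condition with \<open>m - 1\<close>, the
  sum of both halves with \<open>m\<close>. If one half is zero, the other inherits
  \<open>m\<close>; otherwise both satisfy the condition with \<open>m - 1\<close>, and the two
  bounds \<open>2 ^ (m - 1)\<close> add up.\<close>

lemma card_support_ge_power2:
  fixes h :: "'a set \<Rightarrow> 'b::ab_group_add"
  assumes "finite S"
    and "\<And>J. J \<subseteq> S \<Longrightarrow> card J < m \<Longrightarrow> (\<Sum>I | J \<subseteq> I \<and> I \<subseteq> S. h I) = 0"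
    and "I\<^sub>0 \<subseteq> S" "h I\<^sub>0 \<noteq> 0"
  shows "2 ^ m \<le> card {I. I \<subseteq> S \<and> h I \<noteq> 0}"
  using assms
proof (induction S arbitrary: m h I\<^sub>0 rule: finite_induct)
  case empty
  \<comment> \<open>For positive \<open>m\<close>, the condition at \<open>J = {}\<close> would
    force \<open>h {} = 0\<close>, so only the trivial bound 1 remains.\<close>
  have "\<not> 0 < m"
  proof
    assume "0 < m"
    moreover have "{I::'a set. I = {}} = {{}}" by auto
    ultimately show False
      using empty.prems(1)[of "{}"] empty.prems(2,3) by simp
  qed
  moreover have "{I. I \<subseteq> {} \<and> h I \<noteq> 0} = {{}}"
    using empty.prems by auto
  ultimately show ?case by simp
next
  case (insert s S)
  \<comment> \<open>The upper half of the cube, transported to subsets of \<open>S\<close>;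
    \<open>h\<close> itself restricted to these is the lower half.\<close>
  define g where "g I = h (insert s I)" for I
  let ?A = "{I. I \<subseteq> S \<and> h I \<noteq> 0}" and ?B = "{I. I \<subseteq> S \<and> g I \<noteq> 0}"
  have inj: "inj_on (insert s) (Pow S)"
    using insert.hyps(2) by (auto simp: inj_on_def)
  have split: "{I. I \<subseteq> insert s S \<and> P I} = {I. I \<subseteq> S \<and> P I} \<union> insert s ` {I. I \<subseteq> S \<and> P (insert s I)}" for P
  proof (intro equalityI subsetI)
    fix I assume I: "I \<in> {I. I \<subseteq> insert s S \<and> P I}"
    show "I \<in> {I. I \<subseteq> S \<and> P I} \<union> insert s ` {I. I \<subseteq> S \<and> P (insert s I)}"
    proof (cases "s \<in> I")
      case True
      then obtain I' where "I = insert s I'" "s \<notin> I'"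
        by (meson mk_disjoint_insert)
      then show ?thesis using I by auto
    qed (use I in auto)
  qed auto
  have card_split: "card {I. I \<subseteq> insert s S \<and> h I \<noteq> 0} = card ?A + card ?B"
  proof -
    have "card (insert s ` ?B) = card ?B"
      by (rule card_image) (auto intro: inj_on_subset[OF inj])
    moreover have "?A \<inter> insert s ` ?B = {}"
      using insert.hyps(2) by auto
    ultimately show ?thesis
      unfolding split using insert.hyps(1) by (simp add: card_Un_disjoint g_def)
  qed
  have sum_g: "(\<Sum>I | J \<subseteq> I \<and> I \<subseteq> S. g I) = (\<Sum>I | insert s J \<subseteq> I \<and> I \<subseteq> insert s S. h I)"
    if "J \<subseteq> S" for J
  proof -
    have "{I. insert s J \<subseteq> I \<and> I \<subseteq> insert s S} = insert s ` {I. J \<subseteq> I \<and> I \<subseteq> S}"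
    proof (intro equalityI subsetI)
      fix I assume I: "I \<in> {I. insert s J \<subseteq> I \<and> I \<subseteq> insert s S}"
      then obtain I' where "I = insert s I'" "s \<notin> I'"
        by (metis (mono_tags, lifting) insert_subset mem_Collect_eq mk_disjoint_insert)
      then show "I \<in> insert s ` {I. J \<subseteq> I \<and> I \<subseteq> S}"
        using I that insert.hyps(2) by auto
    qed auto
    moreover have "inj_on (insert s) {I. J \<subseteq> I \<and> I \<subseteq> S}"
      by (rule inj_on_subset[OF inj]) auto
    ultimately show ?thesis
      by (simp add: sum.reindex g_def)
  qed
  have sum_h: "(\<Sum>I | J \<subseteq> I \<and> I \<subseteq> S. h I) + (\<Sum>I | J \<subseteq> I \<and> I \<subseteq> S. g I) =
      (\<Sum>I | J \<subseteq> I \<and> I \<subseteq> insert s S. h I)" if "J \<subseteq> S" for J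
  proof -
    have "{I. J \<subseteq> I \<and> I \<subseteq> insert s S} =
        {I. J \<subseteq> I \<and> I \<subseteq> S} \<union> {I. insert s J \<subseteq> I \<and> I \<subseteq> insert s S}"
      by auto
    moreover have "{I. J \<subseteq> I \<and> I \<subseteq> S} \<inter> {I. insert s J \<subseteq> I \<and> I \<subseteq> insert s S} = {}"
      using insert.hyps(2) by auto
    moreover have "finite {I. J \<subseteq> I \<and> I \<subseteq> S}" "finite {I. insert s J \<subseteq> I \<and> I \<subseteq> insert s S}"
      using insert.hyps(1) by simp_all
    ultimately show ?thesis
      unfolding sum_g[OF that] by (simp only: sum.union_disjoint)
  qed
  \<comment> \<open>A sum over the upper half is a sum of \<open>h\<close> over supersets of
    \<open>insert s J\<close>; the extra element costs one order.\<close>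
  have g_order: "(\<Sum>I | J \<subseteq> I \<and> I \<subseteq> S. g I) = 0" if "J \<subseteq> S" "Suc (card J) < m" for J
  proof -
    have "card (insert s J) = Suc (card J)"
      using that insert.hyps by (meson card_insert_disjoint finite_subset subsetD)
    then show ?thesis
      using insert.prems(1)[of "insert s J"] that sum_g[OF that(1)] by auto
  qed
  have hg_order: "(\<Sum>I | J \<subseteq> I \<and> I \<subseteq> S. h I) + (\<Sum>I | J \<subseteq> I \<and> I \<subseteq> S. g I) = 0"
    if "J \<subseteq> S" "card J < m" for J
    using insert.prems(1)[of J] that sum_h[OF that(1)] by auto
  have "I\<^sub>0 \<in> {I. I \<subseteq> insert s S \<and> h I \<noteq> 0}"
    using insert.prems(2,3) by simp
  then have nonempty: "?A \<noteq> {} \<or> ?B \<noteq> {}"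
    unfolding split g_def by blast
  consider "?B = {}" | "?A = {}" | I\<^sub>1 I\<^sub>2 where "I\<^sub>1 \<in> ?A" "I\<^sub>2 \<in> ?B"
    by auto
  then show ?case
  proof cases
    case 1
    then have "(\<Sum>I | J \<subseteq> I \<and> I \<subseteq> S. g I) = 0" for J
      by (intro sum.neutral) auto
    moreover obtain I\<^sub>1 where "I\<^sub>1 \<in> ?A"
      using nonempty 1 by blast
    ultimately have "2 ^ m \<le> card ?A"
      using hg_order by (intro insert.IH[of m h I\<^sub>1]) auto
    then show ?thesis by (simp add: card_split)
  next
    case 2
    then have "(\<Sum>I | J \<subseteq> I \<and> I \<subseteq> S. h I) = 0" for J
      by (intro sum.neutral) auto
    moreover obtain I\<^sub>1 where "I\<^sub>1 \<in> ?B"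
      using nonempty 2 by blast
    ultimately have "2 ^ m \<le> card ?B"
      using hg_order by (intro insert.IH[of m g I\<^sub>1]) auto
    then show ?thesis by (simp add: card_split)
  next
    case 3
    have "2 ^ (m - 1) \<le> card ?B"
      using 3 g_order by (intro insert.IH[of "m - 1" g I\<^sub>2]) auto
    moreover have "2 ^ (m - 1) \<le> card ?A"
    proof (rule insert.IH[of "m - 1" h I\<^sub>1])
      \<comment> \<open>The sum for \<open>h\<close> is the sum for both halves minus the one for
        \<open>g\<close>, and \<open>J\<close> is small enough for both to vanish.\<close>
      show "(\<Sum>I | J \<subseteq> I \<and> I \<subseteq> S. h I) = 0" if "J \<subseteq> S" "card J < m - 1" for J
        using g_order[of J] hg_order[of J] that by simp
    qed (use 3 in auto)
    ultimately have "2 ^ (m - 1) + 2 ^ (m - 1) \<le> card ?A + card ?B"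
      by linarith
    \<comment> \<open>Only an inequality, because \<open>m - 1\<close> truncates when
      \<open>m = 0\<close>.\<close>
    moreover have "(2::nat) ^ m \<le> 2 ^ (m - 1) + 2 ^ (m - 1)"
      by (cases m) auto
    ultimately show ?thesis
      unfolding card_split by linarith
  qed
qed

text \<open>Linear independence of the sequences \<open>u ^ x\<close> for distinct \<open>u\<close>:
  any polynomial in \<open>w i\<close> may replace the powers, in particular one that singles out
  the value \<open>v\<close>.\<close>

lemma sum_fibre_eq_0_if_power_sums_eq_0:
  fixes c w :: "'i \<Rightarrow> 'a::idom"
  assumes "finite A" and "\<And>x::nat. (\<Sum>i\<in>A. c i * w i ^ x) = 0"
  shows "(\<Sum>i | i \<in> A \<and> w i = v. c i) = 0"
proof -
  \<comment> \<open>A Lagrange interpolation polynomial without its normalizing factor: it vanishes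
    at every value of \<open>w\<close> except \<open>v\<close>.\<close>
  define p where "p = (\<Prod>u \<in> w ` A - {v}. [:- u, 1:])"
  have poly_p: "poly p (w i) = (if w i = v then poly p v else 0)" if "i \<in> A" for i
    using that assms(1) by (auto simp: p_def poly_prod intro!: prod_zero)
  have "poly p v \<noteq> 0"
    using assms(1) by (auto simp: p_def poly_prod)
  have "poly p v * (\<Sum>i | i \<in> A \<and> w i = v. c i) = (\<Sum>i\<in>A. c i * poly p (w i))"
    using assms(1)
    by (simp add: poly_p sum_distrib_left sum.inter_filter[symmetric] if_distrib mult.commute cong: sum.cong if_cong)
  also have "\<dots> = (\<Sum>i\<in>A. \<Sum>x\<le>degree p. coeff p x * (c i * w i ^ x))"
    by (simp add: poly_altdef sum_distrib_left mult_ac)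
  also have "\<dots> = (\<Sum>x\<le>degree p. coeff p x * (\<Sum>i\<in>A. c i * w i ^ x))"
    by (subst sum.swap) (simp add: sum_distrib_left)
  also have "\<dots> = 0"
    by (simp add: assms(2))
  finally show ?thesis
    using \<open>poly p v \<noteq> 0\<close> by simp
qed

text \<open>When the product is expanded, a factor with \<open>s\<close> in \<open>J\<close> offers
  no summand 1, so every surviving term has selected all of \<open>J\<close>.\<close>

lemma sum_prod_supersets:
  fixes f :: "'a \<Rightarrow> 'b::comm_ring_1"
  assumes "finite S" "J \<subseteq> S"
  shows "(\<Sum>I | J \<subseteq> I \<and> I \<subseteq> S. prod f I) = (\<Prod>s\<in>S. f s + (if s \<in> J then 0 else 1))"
proof -
  have "(\<Prod>s\<in>S - I. if s \<in> J then 0 else 1 :: 'b) = (if J \<subseteq> I then 1 else 0)" if "I \<subseteq> S" for I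
    using assms that by (auto intro!: prod_zero prod.neutral)
  then have "(\<Prod>s\<in>S. f s + (if s \<in> J then 0 else 1)) =
      (\<Sum>I\<in>Pow S. if J \<subseteq> I then prod f I else 0)"
    unfolding prod_add[OF assms(1)] by (intro sum.cong) auto
  also have "\<dots> = (\<Sum>I | I \<in> Pow S \<and> J \<subseteq> I. prod f I)"
    using assms by (intro sum.inter_filter[symmetric]) auto
  also have "{I. I \<in> Pow S \<and> J \<subseteq> I} = {I. J \<subseteq> I \<and> I \<subseteq> S}"
    by auto
  finally show ?thesis by simp
qed

lemma cis_sum: "cis (sum f A) = (\<Prod>i\<in>A. cis (f i))"
  by (induction A rule: infinite_finite_induct) (auto simp: cis_mult[symmetric])

text \<open>This turns the condition on fractional parts into membership in a fibre of a
  complex-valued function, to which the power sum argument applies.\<close>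

lemma cis_2pi_eq_iff_frac:
  assumes "0 \<le> \<theta>" "\<theta> < 1"
  shows "cis (2 * pi * t) = cis (2 * pi * \<theta>) \<longleftrightarrow> frac t = \<theta>"
proof -
  have "cis (2 * pi * t) = cis (2 * pi * \<theta>) \<longleftrightarrow> (\<exists>z::int. 2 * pi * t = 2 * pi * \<theta> + 2 * pi * z)"
    using sin_cos_eq_iff[of "2 * pi * t" "2 * pi * \<theta>"] by (auto simp: complex_eq_iff)
  also have "\<dots> \<longleftrightarrow> (\<exists>z::int. t = \<theta> + z)"
    by (simp add: distrib_left[symmetric] mult.assoc[symmetric] del: distrib_left_numeral)
  also have "\<dots> \<longleftrightarrow> frac t = \<theta>"
    using assms unfolding frac_unique_iff
    by (metis Ints_cases Ints_of_int add_diff_cancel_left' diff_add_cancel)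
  finally show ?thesis .
qed

lemma m_cover_avoiding:
  assumes "m_cover m k a n" "finite J" "card J < m"
  obtains s where "s \<in> {1..k} - J" "x \<in> residue_class (a s) (n s)"
proof -
  have "card J < card {s \<in> {1..k}. x \<in> residue_class (a s) (n s)}"
    using assms unfolding m_cover_def by (meson less_le_trans)
  then have "\<not> {s \<in> {1..k}. x \<in> residue_class (a s) (n s)} \<subseteq> J"
    using card_mono[OF assms(2)] by (meson not_le)
  then show ?thesis
    using that by auto
qed

lemma m_cover_weighted_sum_eq_0:
  fixes a n c :: "nat \<Rightarrow> int"
  defines "E \<equiv> \<lambda>s. - cis (- (2 * pi * (of_int (a s) * (of_int (c s) / of_int (n s)))))"
  assumes n_pos: "\<And>s. s \<in> {1..k} \<Longrightarrow> n s > 0"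
    and cover: "m_cover m k a n"
    and \<theta>: "0 \<le> \<theta>" "\<theta> < 1"
    and J: "J \<subseteq> {1..k}" "card J < m"
  shows "(\<Sum>I | J \<subseteq> I \<and> I \<subseteq> {1..k}.
      if frac (\<Sum>s\<in>I. real_of_int (c s) / of_int (n s)) = \<theta> then prod E I else 0) = 0"
proof -
  let ?A = "{I. J \<subseteq> I \<and> I \<subseteq> {1..k}}"
  define W where "W s = cis (2 * pi * (of_int (c s) / of_int (n s)))" for s
  have prod_W: "prod W I = cis (2 * pi * (\<Sum>s\<in>I. real_of_int (c s) / of_int (n s)))" for I
    by (simp add: W_def cis_sum sum_distrib_left)
  \<comment> \<open>Natural \<open>x\<close> suffice to separate the fibres of
    \<open>prod W\<close>. The sum factors over the indices, and an index outside \<open>J\<close>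
    whose class contains \<open>x\<close> gives the factor -1 + 1.\<close>
  have "(\<Sum>I\<in>?A. prod E I * prod W I ^ x) = 0" for x :: nat
  proof -
    obtain s where s: "s \<in> {1..k} - J" "int x \<in> residue_class (a s) (n s)"
      using m_cover_avoiding[OF cover finite_subset[OF J(1)] J(2)] by auto
    then obtain q where q: "int x = a s + n s * q"
      by (auto simp: residue_class_def)
    have "real x = of_int (int x)" by simp
    also have "\<dots> = of_int (a s) + of_int (n s) * of_int q"
      unfolding q by simp
    finally have x: "real x = of_int (a s) + of_int (n s) * of_int q" .
    have "n s \<noteq> 0"
      using n_pos[of s] s by auto
    have "E s * W s ^ x = - cis (2 * pi * ((real x - of_int (a s)) * (of_int (c s) / of_int (n s))))"
      by (simp add: E_def W_def DeMoivre cis_mult algebra_simps diff_divide_distrib)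
    also have "(real x - of_int (a s)) * (of_int (c s) / of_int (n s)) = real_of_int (q * c s)"
      using \<open>n s \<noteq> 0\<close> by (simp add: x)
    also have "- cis (2 * pi * real_of_int (q * c s)) = - 1"
      by (subst cis_multiple_2pi) auto
    finally have "E s * W s ^ x + (if s \<in> J then 0 else 1) = 0"
      using s by simp
    then have "(\<Prod>s\<in>{1..k}. E s * W s ^ x + (if s \<in> J then 0 else 1)) = 0"
      using s by (intro prod_zero) auto
    then show ?thesis
      by (subst (asm) sum_prod_supersets[OF _ J(1), symmetric])
        (simp_all add: prod.distrib prod_power_distrib)
  qed
  then have "(\<Sum>I | I \<in> ?A \<and> prod W I = cis (2 * pi * \<theta>). prod E I) = 0"
    by (intro sum_fibre_eq_0_if_power_sums_eq_0) (auto intro: finite_subset[of _ "Pow {1..k}"])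
  then show ?thesis
    unfolding prod_W cis_2pi_eq_iff_frac[OF \<theta>]
    by (subst (asm) sum.inter_filter) (auto intro: finite_subset[of _ "Pow {1..k}"])
qed

theorem theorem1p1:
  fixes m k :: nat and a n c :: "nat \<Rightarrow> int" and \<theta> :: real
  assumes "m > 0"
    and "\<And>s. s \<in> {1..k} \<Longrightarrow> n s > 0"
    and "m_cover m k a n"
    and "0 \<le> \<theta>" and "\<theta> < 1"
  shows "I_A k n c \<theta> = {} \<or> card (I_A k n c \<theta>) \<ge> 2 ^ m"
proof (rule disj_imp[THEN iffD2], rule impI)
  define E where "E s = - cis (- (2 * pi * (of_int (a s) * (of_int (c s) / of_int (n s)))))" for s
  define h where "h I = (if frac (\<Sum>s\<in>I. real_of_int (c s) / of_int (n s)) = \<theta> then prod E I else 0)" for I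
  \<comment> \<open>Values of \<open>cis\<close> never vanish, and an infinite \<open>I\<close>
    gives the default product 1. Hence the support of \<open>h\<close> is exactly
    \<open>I_A\<close>.\<close>
  have "prod E I \<noteq> 0" for I
    by (cases "finite I") (auto simp: E_def)
  then have I_A: "I_A k n c \<theta> = {I. I \<subseteq> {1..k} \<and> h I \<noteq> 0}"
    by (auto simp: I_A_def h_def)
  assume "I_A k n c \<theta> \<noteq> {}"
  then obtain I\<^sub>0 where "I\<^sub>0 \<subseteq> {1..k}" "h I\<^sub>0 \<noteq> 0"
    unfolding I_A by auto
  then show "2 ^ m \<le> card (I_A k n c \<theta>)"
    unfolding I_A h_def E_def
    by (intro card_support_ge_power2 m_cover_weighted_sum_eq_0[OF assms(2,3)] assms(4,5)) auto
qed

end
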